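(* For real numbers $M_1,M_2\ge 0$ and $N_1,N_2>0$, let $S(M_1,N_1,M_2,N_2)$ be the set of pairs $(A,B)\in\mathbb{Z}^2$ such that $M_1\le|A|\le M_1+N_1$, $M_2\le |B|\le M_2+N_2$, the equation $y^2=x^3+Ax+B$ defines an elliptic curve $E$ over $\mathbb{Q}$, and $E[3](\mathbb{Q})\neq\{0_E\}$. Then: \begin{enumerate} \item There is a constant $C>0$ such that for all sufficiently large $J$, $\#S(0,J^2,0,J^3)\le C J^4$. \item Let $0<b<2$ and $0<c<3$. There is a constant $C>0$ such that for all sufficiently large $J$, \[ \#S(J^2-J^b,\,J^b,\,J^3-J^c,\,J^c)\le C\,J^{\,b+c-\frac{\min(b,c)}{2}} . \] \end{enumerate}
   Context: $E[3](\mathbb{Q})$ denotes the group of $\mathbb{Q}$-rational points of $E$ killed by $3$, and $0_E$ is the identity element. *)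

theory Defs
  imports Complex_Main
begin

datatype 'a ec_point = Infinity | Point 'a 'a

text \<open>
  The curve \<open>y\<^sup>2 = x\<^sup>3 + A x + B\<close> is nonsingular iff its discriminant
  \<open>-16 (4 A\<^sup>3 + 27 B\<^sup>2)\<close> does not vanish.
\<close>

definition ec_disc :: "'a::field_char_0 \<Rightarrow> 'a \<Rightarrow> 'a" where
  "ec_disc A B = - 16 * (4 * A ^ 3 + 27 * B ^ 2)"

definition is_elliptic :: "'a::field_char_0 \<Rightarrow> 'a \<Rightarrow> bool" where
  "is_elliptic A B \<longleftrightarrow> ec_disc A B \<noteq> 0"

definition ec_points :: "'a::field_char_0 \<Rightarrow> 'a \<Rightarrow> 'a ec_point set" where
  "ec_points A B = insert Infinity {Point x y | x y. y ^ 2 = x ^ 3 + A * x + B}"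

text \<open>
  Chord-and-tangent addition. The identity is \<open>Infinity\<close>. For two points with the same
  \<open>x\<close>-coordinate that are not opposite to each other, the points coincide and the tangent
  slope is used. The result is meaningful only for points of the curve, where \<open>B\<close> is
  determined by \<open>A\<close> and either point; hence it is not a parameter.
\<close>

fun ec_add :: "'a::field_char_0 \<Rightarrow> 'a ec_point \<Rightarrow> 'a ec_point \<Rightarrow> 'a ec_point" where
  "ec_add A Infinity Q = Q"
| "ec_add A P Infinity = P"
| "ec_add A (Point x1 y1) (Point x2 y2) =
     (if x1 = x2 \<and> y1 = - y2 then Infinity
      else let m = (if x1 = x2 then (3 * x1 ^ 2 + A) / (2 * y1) else (y2 - y1) / (x2 - x1));
               x3 = m ^ 2 - x1 - x2
           in Point x3 (m * (x1 - x3) - y1))"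

definition ec_mult :: "'a::field_char_0 \<Rightarrow> nat \<Rightarrow> 'a ec_point \<Rightarrow> 'a ec_point" where
  "ec_mult A n P = (ec_add A P ^^ n) Infinity"

definition ec_torsion :: "nat \<Rightarrow> 'a::field_char_0 \<Rightarrow> 'a \<Rightarrow> 'a ec_point set" where
  "ec_torsion n A B = {P \<in> ec_points A B. ec_mult A n P = Infinity}"

definition S :: "real \<Rightarrow> real \<Rightarrow> real \<Rightarrow> real \<Rightarrow> (int \<times> int) set" where
  "S M1 N1 M2 N2 = {(A, B).
     M1 \<le> real_of_int \<bar>A\<bar> \<and> real_of_int \<bar>A\<bar> \<le> M1 + N1 \<and>
     M2 \<le> real_of_int \<bar>B\<bar> \<and> real_of_int \<bar>B\<bar> \<le> M2 + N2 \<and>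
     is_elliptic (rat_of_int A) (rat_of_int B) \<and>
     ec_torsion 3 (rat_of_int A) (rat_of_int B) \<noteq> {Infinity}}"

text \<open>The sets counted below are finite, so \<open>card\<close> is the true number of elements.\<close>

lemma finite_S: "finite (S M1 N1 M2 N2)"
proof (rule finite_subset)
  show "S M1 N1 M2 N2 \<subseteq> {- \<lceil>M1 + N1\<rceil>..\<lceil>M1 + N1\<rceil>} \<times> {- \<lceil>M2 + N2\<rceil>..\<lceil>M2 + N2\<rceil>}"
  proof -
    have "- \<lceil>r\<rceil> \<le> k \<and> k \<le> \<lceil>r\<rceil>" if "real_of_int \<bar>k\<bar> \<le> r" for k r
      using that by linarith
    then show ?thesis
      unfolding S_def by auto
  qed
qed simp

lemma Infinity_in_ec_torsion: "Infinity \<in> ec_torsion n A B"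
proof -
  have "(ec_add A Infinity ^^ n) Infinity = Infinity"
    by (induction n) auto
  then show ?thesis
    by (simp add: ec_torsion_def ec_points_def ec_mult_def)
qed

lemma ec_add_closed:
  assumes "P \<in> ec_points A B" "Q \<in> ec_points A B"
  shows "ec_add A P Q \<in> ec_points A B"
proof (cases "P = Infinity \<or> Q = Infinity")
  case True
  then show ?thesis using assms by (cases P; cases Q) auto
next
  case False
  then obtain x1 y1 x2 y2 where PQ: "P = Point x1 y1" "Q = Point x2 y2"
    by (metis ec_point.exhaust)
  have e1: "y1 ^ 2 = x1 ^ 3 + A * x1 + B" and e2: "y2 ^ 2 = x2 ^ 3 + A * x2 + B"
    using assms PQ by (auto simp: ec_points_def)
  have third: "Point (m ^ 2 - x1 - x2) (m * (x1 - (m ^ 2 - x1 - x2)) - y1) \<in> ec_points A B"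
    if m: "2 * m * y1 = x1 ^ 2 + x1 * x2 + x2 ^ 2 + A - m ^ 2 * (x2 - x1)" for m
  proof -
    have "(m * (x1 - (m ^ 2 - x1 - x2)) - y1) ^ 2 =
          (m ^ 2 - x1 - x2) ^ 3 + A * (m ^ 2 - x1 - x2) + B"
      using m e1 by algebra
    then show ?thesis by (simp add: ec_points_def)
  qed
  show ?thesis
  proof (cases "x1 = x2")
    case True
    have "(y1 - y2) * (y1 + y2) = 0"
      using e1 e2 True by algebra
    then have "y1 = y2 \<or> y1 = - y2"
      by (auto simp: eq_neg_iff_add_eq_0)
    moreover have ?thesis if "y1 = y2" "y1 \<noteq> - y2"
    proof -
      have "y1 \<noteq> 0" using that by auto
      then have "2 * ((3 * x1 ^ 2 + A) / (2 * y1)) * y1 = 3 * x1 ^ 2 + A"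
        by (simp add: field_simps)
      then have "2 * ((3 * x1 ^ 2 + A) / (2 * y1)) * y1 = x1 ^ 2 + x1 * x2 + x2 ^ 2 + A
          - ((3 * x1 ^ 2 + A) / (2 * y1)) ^ 2 * (x2 - x1)"
        using True by (simp add: power2_eq_square)
      from third[OF this] show ?thesis
        using PQ that True by (simp add: Let_def)
    qed
    ultimately show ?thesis
      using PQ True by (auto simp: ec_points_def)
  next
    case False
    define m where "m = (y2 - y1) / (x2 - x1)"
    have m: "m * (x2 - x1) = y2 - y1"
      using False by (simp add: m_def)
    have "(x2 - x1) * (2 * m * y1 + m ^ 2 * (x2 - x1)) =
          (x2 - x1) * (x1 ^ 2 + x1 * x2 + x2 ^ 2 + A)"
      using m e1 e2 by algebra
    then have "2 * m * y1 = x1 ^ 2 + x1 * x2 + x2 ^ 2 + A - m ^ 2 * (x2 - x1)"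
      using False by (simp add: eq_diff_eq)
    from third[OF this] show ?thesis
      using PQ False by (simp add: Let_def m_def)
  qed
qed

end

theory Submission
  imports Defs "HOL-Computational_Algebra.Primes" "HOL-Computational_Algebra.Polynomial"
begin

text \<open>
  A rational point of order 3 forces \<open>A = 27 n\<^sup>4 + 6 n k\<close> and \<open>B = k\<^sup>2 - 27 n\<^sup>6\<close> with
  integers \<open>n\<close>, \<open>k\<close>. For \<open>A \<noteq> 0\<close> the integer \<open>n\<close> divides \<open>A\<close> and the pair \<open>(A, n)\<close>
  determines \<open>B\<close>, so the divisor bound \<open>d(A) = O(\<bar>A\<bar> powr \<epsilon>)\<close> leaves few \<open>B\<close> for each \<open>A\<close>.
  In the shell, \<open>A\<close> never vanishes and \<open>\<epsilon> = c / 4\<close> gives \<open>J powr (b + c / 2)\<close>; in the box,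
  \<open>\<epsilon> = 1\<close> suffices, and the row \<open>A = 0\<close> contributes only \<open>O(J\<^sup>3)\<close>.
\<close>

section \<open>The divisor bound\<close>

text \<open>Every divisor of \<open>p ^ a * m\<close> arises as \<open>p ^ i * e\<close> with
  \<open>i \<le> a\<close> and \<open>e dvd m\<close>; surjectivity of this map is enough for an
  upper bound.\<close>

lemma card_divisors_prime_power_mult_le:
  fixes p m :: nat
  assumes "prime p" "m > 0"
  shows "card {d. d dvd p ^ a * m} \<le> (a + 1) * card {d. d dvd m}"
proof -
  let ?D = "{..a} \<times> {d. d dvd m}"
  have fin: "finite ?D"
    using assms by simp
  have "{d. d dvd p ^ a * m} \<subseteq> (\<lambda>(i, e). p ^ i * e) ` ?D"
  proof
    fix d assume "d \<in> {d. d dvd p ^ a * m}"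
    then obtain b e where "d = b * e" "b dvd p ^ a" "e dvd m"
      using division_decomp by blast
    moreover from this obtain i where "i \<le> a" "b = p ^ i"
      using divides_primepow_nat[OF assms(1)] by blast
    ultimately show "d \<in> (\<lambda>(i, e). p ^ i * e) ` ?D"
      by auto
  qed
  then have "card {d. d dvd p ^ a * m} \<le> card ?D"
    using fin surj_card_le by blast
  then show ?thesis
    by (simp add: card_cartesian_product)
qed

text \<open>
  A prime power \<open>p ^ a\<close> contributes the factor \<open>a + 1\<close>, which is at most \<open>p powr (a * \<epsilon>)\<close>
  unless \<open>p powr \<epsilon> < 2\<close>; these finitely many small primes cost a factor \<open>K\<close> each.
\<close>

lemma card_divisors_nat_le_powr:
  fixes \<epsilon> :: real
  assumes "\<epsilon> > 0"
  shows "\<exists>C>0. \<forall>n::nat. n > 0 \<longrightarrow> real (card {d. d dvd n}) \<le> C * real n powr \<epsilon>"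
proof -
  \<comment> \<open>With this \<open>\<delta>\<close>, \<open>exp (\<delta> * a)\<close> equals
    \<open>2 powr (a * \<epsilon>)\<close>; \<open>K\<close> is chosen so that \<open>a + 1 \<le> K
    * (1 + \<delta> * a) \<le> K * exp (\<delta> * a)\<close>.\<close>
  define \<delta> where "\<delta> = \<epsilon> * ln 2"
  define K where "K = 1 + 1 / \<delta>"
  define P where "P = {p::nat. real p powr \<epsilon> < 2}"
  have \<delta>: "\<delta> > 0"
    using assms by (simp add: \<delta>_def)
  then have K: "K \<ge> 1"
    by (simp add: K_def)
  have "P \<subseteq> {..nat \<lceil>2 powr (1 / \<epsilon>)\<rceil>}"
  proof
    fix p assume "p \<in> P"
    then have "(real p powr \<epsilon>) powr (1 / \<epsilon>) \<le> 2 powr (1 / \<epsilon>)"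
      using assms by (intro powr_mono2) (auto simp: P_def)
    then have "real p \<le> 2 powr (1 / \<epsilon>)"
      using assms by (simp add: powr_powr)
    then show "p \<in> {..nat \<lceil>2 powr (1 / \<epsilon>)\<rceil>}"
      by simp linarith
  qed
  then have finP: "finite P"
    using finite_subset by blast
  have small: "real a + 1 \<le> K * (real p ^ a) powr \<epsilon>" if "prime p" for p a :: nat
  proof -
    have "real a + 1 \<le> (1 + 1 / \<delta>) * (1 + \<delta> * real a)"
      using \<delta> by (simp add: field_simps)
    also have "\<dots> \<le> K * exp (\<delta> * real a)"
      unfolding K_def using \<delta> by (intro mult_left_mono exp_ge_add_one_self) auto
    also have "exp (\<delta> * real a) = (2 ^ a) powr \<epsilon>"
      by (simp add: powr_def \<delta>_def ln_realpow mult_ac)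
    also have "\<dots> \<le> (real p ^ a) powr \<epsilon>"
      using assms prime_ge_2_nat[OF that] by (intro powr_mono2 power_mono) auto
    finally show ?thesis
      using K by (simp add: mult_left_mono)
  qed
  have large: "real a + 1 \<le> (real p ^ a) powr \<epsilon>" if "p \<notin> P" for p a :: nat
  proof -
    have "a + 1 \<le> 2 ^ a"
      by (simp add: Suc_leI)
    then have "real (a + 1) \<le> real (2 ^ a)"
      by (simp only: of_nat_le_iff)
    then have "real a + 1 \<le> 2 ^ a"
      by simp
    also have "\<dots> \<le> (real p powr \<epsilon>) ^ a"
      using that by (intro power_mono) (auto simp: P_def)
    also have "\<dots> = (real p ^ a) powr \<epsilon>"
      by (induction a) (simp_all add: powr_mult)
    finally show ?thesis .
  qed
  \<comment> \<open>The exponent of \<open>K\<close> counts only the small primes dividing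
    \<open>n\<close>. The induction strips off the full power of one prime at a time, so each small
    prime is charged once.\<close>
  have main: "real (card {d. d dvd n}) \<le> K ^ card {p \<in> P. prime p \<and> p dvd n} * real n powr \<epsilon>"
    if "n > 0" for n :: nat
    using that
  proof (induction n rule: less_induct)
    case (less n)
    show ?case
    proof (cases "n = 1")
      case True
      then have "{p \<in> P. prime p \<and> p dvd n} = {}"
        by auto
      then have "K ^ card {p \<in> P. prime p \<and> p dvd n} = 1"
        by (simp only: card.empty power_0)
      then show ?thesis
        using True by (simp only:) simp
    next
      case False
      then obtain p where p: "prime p" "p dvd n"
        using prime_factor_nat by blast
      define a where "a = multiplicity p n"
      have "n \<noteq> 0" "\<not> is_unit p"
        using less.prems p by auto
      then obtain m where m: "n = p ^ a * m" "\<not> p dvd m"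
        unfolding a_def by (rule multiplicity_decompose')
      have m0: "m > 0"
        using m less.prems by (cases m) auto
      have "a \<noteq> 0"
        using m p by (intro notI) simp
      then have "p ^ a > 1"
        using prime_gt_1_nat[OF p(1)] by (intro one_less_power) auto
      then have "m < n"
        using m m0 by simp
      note IH = less.IH[OF this m0]
      let ?Q = "\<lambda>n. {p \<in> P. prime p \<and> p dvd n}"
      have fin: "finite (?Q k)" for k
        using finP by simp
      have sub: "?Q m \<subseteq> ?Q n"
        using m by auto
      \<comment> \<open>A small \<open>p\<close> is missing from \<open>?Q m\<close>, as
        \<open>p\<close> does not divide \<open>m\<close>, so the exponent grows by at least one and
        pays for the \<open>K\<close> in \<open>small\<close>; for other \<open>p\<close>,
        \<open>large\<close> costs no \<open>K\<close>.\<close>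
      have step: "(real a + 1) * K ^ card (?Q m) \<le> K ^ card (?Q n) * (real p ^ a) powr \<epsilon>"
      proof (cases "p \<in> P")
        case True
        have "insert p (?Q m) \<subseteq> ?Q n"
          using sub True p by auto
        then have "card (insert p (?Q m)) \<le> card (?Q n)"
          by (intro card_mono fin)
        then have "Suc (card (?Q m)) \<le> card (?Q n)"
          using m fin by simp
        then have "K ^ Suc (card (?Q m)) \<le> K ^ card (?Q n)"
          using K by (intro power_increasing)
        then have "K ^ Suc (card (?Q m)) * (real p ^ a) powr \<epsilon> \<le> K ^ card (?Q n) * (real p ^ a) powr \<epsilon>"
          by (intro mult_right_mono) auto
        moreover have "(real a + 1) * K ^ card (?Q m) \<le> (K * (real p ^ a) powr \<epsilon>) * K ^ card (?Q m)"
          using K small[OF p(1)] by (intro mult_right_mono) auto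
        ultimately show ?thesis
          by (simp add: mult_ac)
      next
        case False
        have "K ^ card (?Q m) \<le> K ^ card (?Q n)"
          using K sub by (intro power_increasing card_mono fin)
        then have "(real a + 1) * K ^ card (?Q m) \<le> (real p ^ a) powr \<epsilon> * K ^ card (?Q n)"
          using K large[OF False] by (intro mult_mono) auto
        then show ?thesis
          by (simp add: mult_ac)
      qed
      have "real (card {d. d dvd n}) \<le> (real a + 1) * real (card {d. d dvd m})"
        using of_nat_mono[OF card_divisors_prime_power_mult_le[OF p(1) m0, of a], where 'a = real]
        unfolding m(1) by (simp add: algebra_simps)
      also have "\<dots> \<le> (real a + 1) * (K ^ card (?Q m) * real m powr \<epsilon>)"
        using IH by (intro mult_left_mono) auto
      also have "\<dots> \<le> (K ^ card (?Q n) * (real p ^ a) powr \<epsilon>) * real m powr \<epsilon>"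
        using step by (simp add: mult_right_mono flip: mult.assoc)
      also have "\<dots> = K ^ card (?Q n) * real n powr \<epsilon>"
        by (subst (2) m(1)) (simp add: powr_mult)
      finally show ?thesis .
    qed
  qed
  have "real (card {d. d dvd n}) \<le> K ^ card P * real n powr \<epsilon>" if "n > 0" for n :: nat
  proof -
    \<comment> \<open>Passing to all of \<open>P\<close> makes the constant independent of
      \<open>n\<close>.\<close>
    have "K ^ card {p \<in> P. prime p \<and> p dvd n} \<le> K ^ card P"
      using K finP by (intro power_increasing card_mono) auto
    then have "K ^ card {p \<in> P. prime p \<and> p dvd n} * real n powr \<epsilon> \<le> K ^ card P * real n powr \<epsilon>"
      by (intro mult_right_mono) auto
    then show ?thesis
      using main[OF that] by linarith
  qed
  then show ?thesis
    using K by (intro exI[of _ "K ^ card P"]) auto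
qed

lemma card_divisors_int_le_powr:
  fixes \<epsilon> :: real
  assumes "\<epsilon> > 0"
  shows "\<exists>C>0. \<forall>a::int. a \<noteq> 0 \<longrightarrow> real (card {d. d dvd a}) \<le> C * \<bar>real_of_int a\<bar> powr \<epsilon>"
proof -
  obtain C where C: "C > 0" "\<And>n::nat. n > 0 \<Longrightarrow> real (card {d. d dvd n}) \<le> C * real n powr \<epsilon>"
    using card_divisors_nat_le_powr[OF assms] by blast
  have "real (card {d. d dvd a}) \<le> 2 * C * \<bar>real_of_int a\<bar> powr \<epsilon>" if "a \<noteq> 0" for a :: int
  proof -
    define n where "n = nat \<bar>a\<bar>"
    let ?D = "{d. d dvd n}"
    have n: "n > 0" "real n = \<bar>real_of_int a\<bar>"
      using that by (auto simp: n_def)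
    have fin: "finite ?D"
      using n by simp
    have "{d. d dvd a} \<subseteq> int ` ?D \<union> (\<lambda>d. - int d) ` ?D"
    proof
      fix d assume "d \<in> {d. d dvd a}"
      then have "nat \<bar>d\<bar> \<in> ?D"
        by (simp add: n_def nat_abs_dvd_iff)
      moreover have "d = int (nat \<bar>d\<bar>) \<or> d = - int (nat \<bar>d\<bar>)"
        by auto
      ultimately show "d \<in> int ` ?D \<union> (\<lambda>d. - int d) ` ?D"
        by blast
    qed
    then have "card {d. d dvd a} \<le> card (int ` ?D \<union> (\<lambda>d. - int d) ` ?D)"
      using fin by (intro card_mono) auto
    also have "\<dots> \<le> card ?D + card ?D"
      using fin by (intro order_trans[OF card_Un_le] add_mono card_image_le)
    finally have "real (card {d. d dvd a}) \<le> 2 * real (card ?D)"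
      by linarith
    also have "\<dots> \<le> 2 * C * \<bar>real_of_int a\<bar> powr \<epsilon>"
      using C(2)[OF n(1)] n(2) by simp
    finally show ?thesis .
  qed
  then show ?thesis
    using C(1) by (intro exI[of _ "2 * C"]) auto
qed

section \<open>Parametrization of curves with a rational 3-torsion point\<close>

text \<open>
  A point of order 3 is a flex. Its tangent line \<open>y = 3 n x + k\<close> meets the curve with
  multiplicity three at \<open>x = 3 n\<^sup>2\<close>; compare coefficients in
  \<open>x\<^sup>3 + A x + B - (3 n x + k)\<^sup>2 = (x - 3 n\<^sup>2)\<^sup>3\<close>.
\<close>

lemma three_torsion_parametrization:
  fixes A B :: "'a::field_char_0"
  assumes "ec_torsion 3 A B \<noteq> {Infinity}"
  shows "\<exists>n k. A = 27 * n ^ 4 + 6 * n * k \<and> B = k ^ 2 - 27 * n ^ 6"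
proof -
  obtain P where P: "P \<in> ec_torsion 3 A B" "P \<noteq> Infinity"
    using assms Infinity_in_ec_torsion[of 3 A B] by blast
  then obtain x y where xy: "P = Point x y"
    by (cases P) auto
  have curve: "y ^ 2 = x ^ 3 + A * x + B"
    using P xy by (auto simp: ec_torsion_def ec_points_def)
  have tors: "ec_add A (Point x y) (ec_add A (Point x y) (Point x y)) = Infinity"
    using P xy by (simp add: ec_torsion_def ec_mult_def numeral_3_eq_3)
  \<comment> \<open>If \<open>y = 0\<close>, then P + P is \<open>Infinity\<close> and 3P = P, which
    is not the identity.\<close>
  have y0: "y \<noteq> 0"
    using tors by auto
  then have "y \<noteq> - y"
    by (simp add: eq_neg_iff_add_eq_0 flip: mult_2)
  \<comment> \<open>A third of the tangent slope.\<close>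
  define n where "n = (3 * x ^ 2 + A) / (6 * y)"
  have slope: "(3 * x ^ 2 + A) / (2 * y) = 3 * n"
    using y0 by (simp add: n_def field_simps)
  then have n: "6 * n * y = 3 * x ^ 2 + A"
    using y0 by (simp add: field_simps)
  \<comment> \<open>3P is the identity, so 2P = -P has the same abscissa as P: slope^2 - 2x =
    x.\<close>
  have "(3 * n) ^ 2 = 3 * x"
    using tors \<open>y \<noteq> - y\<close> by (auto simp: Let_def slope split: if_splits)
  then have x: "x = 3 * n ^ 2"
    by (simp add: power2_eq_square)
  have "A = 27 * n ^ 4 + 6 * n * (y - 3 * n * x)"
    using n x by algebra
  moreover have "B = (y - 3 * n * x) ^ 2 - 27 * n ^ 6"
    using n x curve by algebra
  ultimately show ?thesis
    by blast
qed

text \<open>The rational parameters are roots of monic integer polynomials, so integrality follows.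
  This is shown first for \<open>3 * n\<close>, then for \<open>n\<close> by divisibility by 3, and
  finally for \<open>k\<close>.\<close>

lemma three_torsion_parametrization_int:
  fixes A B :: int
  assumes "ec_torsion 3 (rat_of_int A) (rat_of_int B) \<noteq> {Infinity}"
  shows "\<exists>n k. A = 27 * n ^ 4 + 6 * n * k \<and> B = k ^ 2 - 27 * n ^ 6"
proof -
  obtain n k :: rat where nk: "of_int A = 27 * n ^ 4 + 6 * n * k" "of_int B = k ^ 2 - 27 * n ^ 6"
    using three_torsion_parametrization[OF assms] by blast
  have "algebraic_int (3 * n)"
  proof (rule algebraic_int.intros)
    \<comment> \<open>Eliminating \<open>k\<close> from the two formulas gives this relation for t =
      \<open>3 * n\<close>. It is 27 times the 3-division polynomial 3x^4 + 6Ax^2 + 12Bx - A^2 at x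
      = t^2 / 3.\<close>
    let ?p = "[:- 27 * of_int A ^ 2, 0, 108 * of_int B, 0, 18 * of_int A, 0, 0, 0, 1:] :: rat poly"
    show "lead_coeff ?p = 1" by simp
    show "\<forall>i. coeff ?p i \<in> \<int>"
      by (auto simp: coeff_pCons split: nat.splits)
    show "poly ?p (3 * n) = 0"
      by (simp add: nk) algebra
  qed
  then have "3 * n \<in> \<int>"
    by (rule rational_algebraic_int_is_int) (simp add: Rats_def of_rat_eq_id)
  then obtain m where m: "3 * n = of_int m"
    by (auto elim: Ints_cases)
  \<comment> \<open>In the same relation every coefficient but the leading one is divisible by 3,
    which forces \<open>3 dvd m\<close>.\<close>
  have "rat_of_int (m ^ 8) = of_int (3 * (9 * A ^ 2 - 6 * A * m ^ 4 - 36 * B * m ^ 2))"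
    by (simp add: nk m[symmetric]) algebra
  then have "m ^ 8 = 3 * (9 * A ^ 2 - 6 * A * m ^ 4 - 36 * B * m ^ 2)"
    by (simp only: of_int_eq_iff)
  then have "3 dvd m ^ 8" by simp
  then have "3 dvd m"
    using prime_dvd_power[of 3 m 8] by simp
  then obtain n' where n': "m = 3 * n'" by auto
  then have n: "n = of_int n'"
    using m by simp
  \<comment> \<open>Now \<open>k ^ 2 = B + 27 * n ^ 6\<close> is an integer.\<close>
  have "algebraic_int k"
  proof (rule algebraic_int.intros)
    let ?p = "[:- of_int (B + 27 * n' ^ 6), 0, 1:] :: rat poly"
    show "lead_coeff ?p = 1" by simp
    show "\<forall>i. coeff ?p i \<in> \<int>"
      by (auto simp: coeff_pCons split: nat.splits)
    show "poly ?p k = 0"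
      by (simp add: nk n power2_eq_square)
  qed
  then have "k \<in> \<int>"
    by (rule rational_algebraic_int_is_int) (simp add: Rats_def of_rat_eq_id)
  then obtain k' where k: "k = of_int k'"
    by (auto elim: Ints_cases)
  have "rat_of_int A = of_int (27 * n' ^ 4 + 6 * n' * k')" "rat_of_int B = of_int (k' ^ 2 - 27 * n' ^ 6)"
    using nk by (simp_all add: n k)
  then show ?thesis
    unfolding of_int_eq_iff by blast
qed

section \<open>Counting pairs through divisors of \<open>A\<close>\<close>

text \<open>Taking a subset \<open>W\<close> allows the row \<open>A = 0\<close> to be removed
  first: there \<open>n = 0\<close> can occur, which leaves \<open>k\<close>, and hence
  \<open>B = k ^ 2\<close>, undetermined.\<close>

lemma card_S_le:
  fixes X :: "int set" and D :: real
  assumes "finite X" "0 \<notin> X" "W \<subseteq> S M1 N1 M2 N2" "fst ` W \<subseteq> X"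
    and D: "\<And>A. A \<in> X \<Longrightarrow> real (card {n. n dvd A}) \<le> D"
  shows "real (card W) \<le> real (card X) * D"
proof -
  let ?Y = "SIGMA A:X. {n. n dvd A}"
  \<comment> \<open>The quotient recovers \<open>k\<close>; the division is exact because
    \<open>A - 27 * n ^ 4 = 6 * n * k\<close> with \<open>n \<noteq> 0\<close>.\<close>
  let ?f = "\<lambda>(A, n). (A, ((A - 27 * n ^ 4) div (6 * n)) ^ 2 - 27 * n ^ 6)"
  have fin: "finite {n. n dvd A}" if "A \<in> X" for A :: int
    using that assms by (auto intro!: finite_divisors_int)
  have "W \<subseteq> ?f ` ?Y"
  proof
    fix w assume w: "w \<in> W"
    obtain A B where AB: "w = (A, B)" by (cases w)
    have A: "A \<in> X" "A \<noteq> 0"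
      using w AB assms by force+
    have "ec_torsion 3 (rat_of_int A) (rat_of_int B) \<noteq> {Infinity}"
      using w AB assms(3) by (auto simp: S_def)
    then obtain n k where nk: "A = 27 * n ^ 4 + 6 * n * k" "B = k ^ 2 - 27 * n ^ 6"
      using three_torsion_parametrization_int by blast
    then have "n \<noteq> 0"
      using A by auto
    then have "?f (A, n) = w"
      using nk AB by simp
    moreover have "A = n * (27 * n ^ 3 + 6 * k)"
      unfolding nk(1) by algebra
    then have "n dvd A"
      by simp
    ultimately show "w \<in> ?f ` ?Y"
      using A by blast
  qed
  then have "card W \<le> card ?Y"
    using assms(1) fin by (intro surj_card_le) auto
  also have "card ?Y = (\<Sum>A\<in>X. card {n. n dvd A})"
    using assms(1) fin by simp
  finally have "real (card W) \<le> (\<Sum>A\<in>X. real (card {n. n dvd A}))"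
    by (simp flip: of_nat_sum)
  also have "\<dots> \<le> real (card X) * D"
    using D by (intro sum_bounded_above)
  finally show ?thesis .
qed

lemma card_int_abs_between_le:
  fixes u v :: real
  assumes "u \<le> v"
  shows "finite {a::int. u \<le> \<bar>real_of_int a\<bar> \<and> \<bar>real_of_int a\<bar> \<le> v}"
    and "real (card {a::int. u \<le> \<bar>real_of_int a\<bar> \<and> \<bar>real_of_int a\<bar> \<le> v}) \<le> 2 * (v - u) + 2"
proof -
  let ?I = "{\<lceil>u\<rceil>..\<lfloor>v\<rfloor>}"
  let ?X = "{a::int. u \<le> \<bar>real_of_int a\<bar> \<and> \<bar>real_of_int a\<bar> \<le> v}"
  have sub: "?X \<subseteq> ?I \<union> uminus ` ?I"
  proof
    fix a assume "a \<in> ?X"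
    then have "\<bar>a\<bar> \<in> ?I"
      by (auto simp: ceiling_le_iff le_floor_iff)
    then have "a \<in> ?I \<or> - a \<in> ?I"
      by (cases "a \<ge> 0") auto
    then show "a \<in> ?I \<union> uminus ` ?I"
      by (metis UnCI add.inverse_inverse imageI)
  qed
  then show "finite ?X"
    by (rule finite_subset) simp
  have "card ?X \<le> card (?I \<union> uminus ` ?I)"
    using sub by (intro card_mono) auto
  also have "\<dots> \<le> card ?I + card ?I"
    by (intro order_trans[OF card_Un_le] add_mono card_image_le) auto
  finally have "real (card ?X) \<le> 2 * real (card ?I)" by linarith
  also have "real (card ?I) \<le> v - u + 1"
    using assms by simp linarith
  finally show "real (card ?X) \<le> 2 * (v - u) + 2" by simp
qed

section \<open>The box and the shell\<close>

lemma card_S_box_bound: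
  "\<exists>C>0. \<forall>\<^sub>F J::real in at_top. real (card (S 0 (J ^ 2) 0 (J ^ 3))) \<le> C * J ^ 4"
proof -
  obtain C where C: "C > 0"
    "\<And>a::int. a \<noteq> 0 \<Longrightarrow> real (card {d. d dvd a}) \<le> C * \<bar>real_of_int a\<bar> powr 1"
    using card_divisors_int_le_powr[of 1] by auto
  have "real (card (S 0 (J ^ 2) 0 (J ^ 3))) \<le> (4 * C + 4) * J ^ 4" if J: "J \<ge> 1" for J :: real
  proof -
    let ?S = "S 0 (J ^ 2) 0 (J ^ 3)"
    \<comment> \<open>The lower end 1 excludes \<open>A = 0\<close> and makes the count at most
      \<open>2 * (J ^ 2 - 1) + 2 = 2 * J ^ 2\<close>.\<close>
    let ?X = "{a::int. 1 \<le> \<bar>real_of_int a\<bar> \<and> \<bar>real_of_int a\<bar> \<le> J ^ 2}"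
    let ?Y = "{b::int. 0 \<le> \<bar>real_of_int b\<bar> \<and> \<bar>real_of_int b\<bar> \<le> J ^ 3}"
    let ?W = "{w \<in> ?S. fst w \<noteq> 0}"
    have J2: "1 \<le> J ^ 2" and J34: "1 \<le> J ^ 3" "J ^ 3 \<le> J ^ 4"
      using J by (auto intro: power_increasing)
    have "real (card ?W) \<le> real (card ?X) * (C * J ^ 2)"
    proof (rule card_S_le)
      show "finite ?X"
        by (rule card_int_abs_between_le(1)[OF J2])
      show "?W \<subseteq> ?S" by auto
      show "fst ` ?W \<subseteq> ?X"
        by (auto simp: S_def)
      show "real (card {n. n dvd A}) \<le> C * J ^ 2" if "A \<in> ?X" for A
      proof -
        have "real (card {n. n dvd A}) \<le> C * \<bar>real_of_int A\<bar>"
          using C(2)[of A] that by auto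
        also have "\<dots> \<le> C * J ^ 2"
          using that C(1) by (intro mult_left_mono) auto
        finally show ?thesis .
      qed
    qed auto
    also have "\<dots> \<le> (2 * J ^ 2) * (C * J ^ 2)"
      using card_int_abs_between_le(2)[OF J2] C(1) J by (intro mult_right_mono) auto
    also have "\<dots> = 2 * C * J ^ 4"
      by (simp add: power2_eq_square power4_eq_xxxx)
    finally have W: "real (card ?W) \<le> 2 * C * J ^ 4" .
    have J3: "0 \<le> J ^ 3" using J34 by linarith
    \<comment> \<open>The row \<open>A = 0\<close> is bounded by all admissible \<open>B\<close>, at
      most \<open>2 * J ^ 3 + 2 \<le> 4 * J ^ 4\<close> of them.\<close>
    have "?S \<subseteq> ?W \<union> {0} \<times> ?Y"
      by (auto simp: S_def)
    then have "card ?S \<le> card (?W \<union> {0} \<times> ?Y)"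
      using card_int_abs_between_le(1)[OF J3] finite_S[of 0 "J ^ 2" 0 "J ^ 3"]
      by (intro card_mono) auto
    also have "\<dots> \<le> card ?W + card ?Y"
      using card_Un_le[of ?W "{0::int} \<times> ?Y"] by (simp add: card_cartesian_product_singleton)
    finally have "real (card ?S) \<le> real (card ?W) + real (card ?Y)"
      by linarith
    also have "real (card ?Y) \<le> 4 * J ^ 4"
      using card_int_abs_between_le(2)[OF J3] J34 by simp
    finally have "real (card ?S) \<le> 2 * C * J ^ 4 + 4 * J ^ 4"
      using W by linarith
    also have "\<dots> \<le> (4 * C + 4) * J ^ 4"
      using C(1) J by (simp add: algebra_simps)
    finally show ?thesis .
  qed
  then show ?thesis
    using C(1) by (intro exI[of _ "4 * C + 4"] conjI eventually_at_top_linorderI[of 1]) auto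
qed

lemma card_S_shell_bound:
  fixes b c :: real
  assumes "0 < b" "b < 2" "0 < c"
  shows "\<exists>C>0. \<forall>\<^sub>F J::real in at_top.
    real (card (S (J ^ 2 - J powr b) (J powr b) (J ^ 3 - J powr c) (J powr c)))
      \<le> C * J powr (b + c - min b c / 2)"
proof -
  \<comment> \<open>Since \<open>\<bar>A\<bar> \<le> J ^ 2\<close>, the exponent
    \<open>c / 4\<close> yields at most \<open>C * J powr (c / 2)\<close> divisors.\<close>
  obtain C where C: "C > 0"
    "\<And>a::int. a \<noteq> 0 \<Longrightarrow> real (card {d. d dvd a}) \<le> C * \<bar>real_of_int a\<bar> powr (c / 4)"
    using card_divisors_int_le_powr[of "c / 4"] assms by auto
  have "real (card (S (J ^ 2 - J powr b) (J powr b) (J ^ 3 - J powr c) (J powr c)))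
      \<le> 4 * C * J powr (b + c - min b c / 2)" if J: "J > 1" for J :: real
  proof -
    let ?S = "S (J ^ 2 - J powr b) (J powr b) (J ^ 3 - J powr c) (J powr c)"
    let ?X = "{a::int. J ^ 2 - J powr b \<le> \<bar>real_of_int a\<bar> \<and> \<bar>real_of_int a\<bar> \<le> J ^ 2}"
    have le: "J ^ 2 - J powr b \<le> J ^ 2" by simp
    \<comment> \<open>Here \<open>b < 2\<close> keeps the inner radius of the shell positive, hence
      \<open>A \<noteq> 0\<close>.\<close>
    have "J powr b < J powr 2"
      using J assms by (intro powr_less_mono) auto
    then have pos: "J powr b < J ^ 2"
      using J by simp
    have "real (card ?S) \<le> real (card ?X) * (C * J powr (c / 2))"
    proof (rule card_S_le)
      show "finite ?X"
        by (rule card_int_abs_between_le(1)[OF le])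
      show "0 \<notin> ?X"
        using pos by simp
      show "fst ` ?S \<subseteq> ?X"
        by (auto simp: S_def)
      show "real (card {n. n dvd A}) \<le> C * J powr (c / 2)" if "A \<in> ?X" for A
      proof -
        have "A \<noteq> 0" using that pos by auto
        then have "real (card {n. n dvd A}) \<le> C * \<bar>real_of_int A\<bar> powr (c / 4)"
          by (rule C(2))
        also have "\<dots> \<le> C * (J powr 2) powr (c / 4)"
          using that C(1) J assms by (intro mult_left_mono powr_mono2) auto
        also have "\<dots> = C * J powr (c / 2)"
          by (simp add: powr_powr)
        finally show ?thesis .
      qed
    qed (rule order_refl)
    also have "\<dots> \<le> (4 * J powr b) * (C * J powr (c / 2))"
    proof (intro mult_right_mono)
      \<comment> \<open>This absorbs the additive 2 in the count
        \<open>2 * J powr b + 2\<close>.\<close>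
      have "1 \<le> J powr b"
        using J assms by (simp add: ge_one_powr_ge_zero)
      then show "real (card ?X) \<le> 4 * J powr b"
        using card_int_abs_between_le(2)[OF le] by simp
    qed (use C(1) in auto)
    also have "\<dots> = 4 * C * J powr (b + c / 2)"
      by (simp add: powr_add)
    \<comment> \<open>\<open>min b c \<le> c\<close> gives
      \<open>b + c / 2 \<le> b + c - min b c / 2\<close>.\<close>
    also have "\<dots> \<le> 4 * C * J powr (b + c - min b c / 2)"
      using C(1) J by (intro mult_left_mono powr_mono) auto
    finally show ?thesis .
  qed
  then show ?thesis
    using C(1) by (intro exI[of _ "4 * C"] conjI eventually_mono[OF eventually_gt_at_top[of 1]]) auto
qed

theorem corollary7p2:
  shows "(\<exists>C>0. \<forall>\<^sub>F J::real in at_top.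
            real (card (S 0 (J ^ 2) 0 (J ^ 3))) \<le> C * J ^ 4)
       \<and> (\<forall>b c::real. 0 < b \<longrightarrow> b < 2 \<longrightarrow> 0 < c \<longrightarrow> c < 3 \<longrightarrow>
           (\<exists>C>0. \<forall>\<^sub>F J::real in at_top.
              real (card (S (J ^ 2 - J powr b) (J powr b) (J ^ 3 - J powr c) (J powr c)))
                \<le> C * J powr (b + c - min b c / 2)))"
  using card_S_box_bound card_S_shell_bound by blast

end
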